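(* Let $(X,d)$ be a metric space, let $\mathcal{B}$ be its ball cover and $\mathcal{M}$ its maximal-clique cover. Then the persistence modules of the Čech filtration and of the Vietoris–Rips filtration, $H_*\mathrm{Nrv}\,\mathcal{B}$ and $H_*\mathrm{CoNrv}\,\mathcal{M}$, are $2$-approximated.
   Context: $\mathbb{R}_+=[0,\infty)$. A cover of a set $X$ is an indexed family $\mathcal{U}=\{U_i\}_{i\in I}$ of sets with $X=\bigcup_{i\in I}U_i$. A refinement map $\{V_j\}_{j\in J}\to\{U_i\}_{i\in I}$ is a function $f:J\to I$ with $V_j\subseteq U_{f(j)}$ for all $j$. The ball cover at scale $r$ is $\mathcal{B}(r)=\{B(x,r)\}_{x\in X}$ (indexed by $X$), where $B(x,r)=\{y\in X: d(x,y)\le r\}$. A subset $M\subseteq X$ is an $r$-clique if $\mathrm{diam}(M)\le r$, and is maximal if it is not properly contained in another $r$-clique. The maximal-clique cover at scale $r$ is $\mathcal{M}(r)=\{M: M \text{ is a maximal } r\text{-clique}\}$. The nerve $\mathrm{Nrv}(\mathcal{U})$ is the simplicial complex whose simplices are the finite nonempty $\sigma\subseteq I$ with $\bigcap_{i\in\sigma}U_i\ne\emptyset$. The co-nerve $\mathrm{CoNrv}(\mathcal{U})$ has as simplices the finite nonempty $\sigma\subseteq X$ with $\sigma\subseteq U_i$ for some $i$. $H_*$ is simplicial homology with coefficients in a fixed field. For $r\le s$, the complexes $\mathrm{Nrv}(\mathcal{B}(r))\subseteq\mathrm{Nrv}(\mathcal{B}(s))$ and $\mathrm{CoNrv}(\mathcal{M}(r))\subseteq\mathrm{CoNrv}(\mathcal{M}(s))$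 are nested (all on vertex set $X$), and the structure maps of the persistence modules are induced by these inclusions. $\mathrm{CoNrv}(\mathcal{M}(r))$ is the Vietoris–Rips complex at scale $r$. A persistence module is a functor from $(\mathbb{R}_+,\le)$ to vector spaces. Persistence modules $F,G$ are $c$-approximated ($c\ge1$) if there are natural transformations $\phi:F\Rightarrow G\circ S_c$ and $\psi:G\Rightarrow F\circ S_c$, with $S_c(r)=cr$, such that $\psi_{cr}\circ\phi_r=F(r\le c^2r)$ and $\phi_{cr}\circ\psi_r=G(r\le c^2r)$ for all $r$. *)

theory Defs
  imports
    "HOL-Analysis.Abstract_Metric_Spaces"
    "HOL-Library.Extended_Nonnegative_Real"
    "HOL-Combinatorics.Permutations"
    "HOL-Algebra.Module"
    "HOL-Algebra.AbelCoset"
begin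

section \<open>Covers of a metric space, nerves and co-nerves\<close>

text \<open>An indexed family of sets is given by its index set \<open>I\<close> and the map \<open>U\<close> on indices.
  A set of sets is regarded as a family indexed by itself.\<close>

definition nerve :: "'i set \<Rightarrow> ('i \<Rightarrow> 'a set) \<Rightarrow> 'i set set" where
  "nerve I U = {\<sigma>. finite \<sigma> \<and> \<sigma> \<noteq> {} \<and> \<sigma> \<subseteq> I \<and> (\<Inter>i\<in>\<sigma>. U i) \<noteq> {}}"

definition conerve :: "'a set \<Rightarrow> 'i set \<Rightarrow> ('i \<Rightarrow> 'a set) \<Rightarrow> 'a set set" where
  "conerve X I U = {\<sigma>. finite \<sigma> \<and> \<sigma> \<noteq> {} \<and> \<sigma> \<subseteq> X \<and> (\<exists>i\<in>I. \<sigma> \<subseteq> U i)}"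

definition ball_cover :: "'a set \<Rightarrow> ('a \<Rightarrow> 'a \<Rightarrow> real) \<Rightarrow> real \<Rightarrow> 'a \<Rightarrow> 'a set" where
  "ball_cover X d r x = Metric_space.mcball X d x r"

text \<open>The diameter takes values in \<open>[0,\<infinity>]\<close>, so that unbounded sets have diameter \<open>\<infinity>\<close> and the
  empty set has diameter \<open>0\<close>.\<close>

definition diam :: "('a \<Rightarrow> 'a \<Rightarrow> real) \<Rightarrow> 'a set \<Rightarrow> ennreal" where
  "diam d M = (SUP x\<in>M. SUP y\<in>M. ennreal (d x y))"

definition clique :: "'a set \<Rightarrow> ('a \<Rightarrow> 'a \<Rightarrow> real) \<Rightarrow> real \<Rightarrow> 'a set \<Rightarrow> bool" where
  "clique X d r M \<longleftrightarrow> M \<subseteq> X \<and> diam d M \<le> ennreal r"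

definition maximal_cliques :: "'a set \<Rightarrow> ('a \<Rightarrow> 'a \<Rightarrow> real) \<Rightarrow> real \<Rightarrow> 'a set set" where
  "maximal_cliques X d r = {M. clique X d r M \<and> \<not> (\<exists>M'. clique X d r M' \<and> M \<subset> M')}"

definition cech :: "'a set \<Rightarrow> ('a \<Rightarrow> 'a \<Rightarrow> real) \<Rightarrow> real \<Rightarrow> 'a set set" where
  "cech X d r = nerve X (ball_cover X d r)"

definition vietoris_rips :: "'a set \<Rightarrow> ('a \<Rightarrow> 'a \<Rightarrow> real) \<Rightarrow> real \<Rightarrow> 'a set set" where
  "vietoris_rips X d r = conerve X (maximal_cliques X d r) (\<lambda>M. M)"


section \<open>Vector spaces: linear maps and quotients\<close>

text \<open>A vector space over a field \<open>K\<close> is a \<^term>\<open>module K V\<close>. The ring multiplication and unit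
  that a module record also carries are irrelevant and left \<open>undefined\<close> below.\<close>

definition linear_maps ::
  "('k, 'b) module \<Rightarrow> ('k, 'c) module \<Rightarrow> ('k, 'm) ring_scheme \<Rightarrow> ('b \<Rightarrow> 'c) set" where
  "linear_maps V W K = {f \<in> carrier V \<rightarrow> carrier W.
     (\<forall>x\<in>carrier V. \<forall>y\<in>carrier V. f (x \<oplus>\<^bsub>V\<^esub> y) = f x \<oplus>\<^bsub>W\<^esub> f y) \<and>
     (\<forall>a\<in>carrier K. \<forall>x\<in>carrier V. f (a \<odot>\<^bsub>V\<^esub> x) = a \<odot>\<^bsub>W\<^esub> f x)}"

definition quotient_module :: "('k, 'b) module \<Rightarrow> 'b set \<Rightarrow> ('k, 'b set) module" where
  "quotient_module V N =
     \<lparr>carrier = a_rcosets\<^bsub>V\<^esub> N, mult = undefined, one = undefined,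
      zero = N, add = set_add V,
      smult = (\<lambda>a C. \<Union>x\<in>C. N +>\<^bsub>V\<^esub> (a \<odot>\<^bsub>V\<^esub> x))\<rparr>"


section \<open>Simplicial homology\<close>

text \<open>Oriented simplicial chains: an orientation of an \<open>n\<close>-simplex is an ordering of its vertices
  (a distinct list of length \<open>n + 1\<close>) up to even permutation, and an \<open>n\<close>-chain is a finitely
  supported function on oriented \<open>n\<close>-simplices that changes sign when the orientation is
  reversed. Chains are \<open>\<zero>\<close> on every other list; hence the inclusion of a subcomplex induces the
  literal inclusion on chains.\<close>

definition chains :: "('k, 'm) ring_scheme \<Rightarrow> 'a set set \<Rightarrow> nat \<Rightarrow> ('a list \<Rightarrow> 'k) set" where
  "chains K \<Delta> n = {c \<in> UNIV \<rightarrow> carrier K.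
     finite {xs. c xs \<noteq> \<zero>\<^bsub>K\<^esub>} \<and>
     (\<forall>xs. c xs \<noteq> \<zero>\<^bsub>K\<^esub> \<longrightarrow> distinct xs \<and> length xs = Suc n \<and> set xs \<in> \<Delta>) \<and>
     (\<forall>xs p. p permutes {..<length xs} \<longrightarrow>
        c (permute_list p xs) = (if evenperm p then c xs else \<ominus>\<^bsub>K\<^esub> c xs))}"

text \<open>The linear extension of
  \<open>\<partial>[v\<^sub>0,\<dots>,v\<^sub>n] = (\<Sum>i\<le>n. (-1)\<^sup>i [v\<^sub>0,\<dots>,v\<^sub>i\<^sub>-\<^sub>1,v\<^sub>i\<^sub>+\<^sub>1,\<dots>,v\<^sub>n])\<close>. Its coefficient at an oriented
  simplex \<open>ws\<close> collects the simplices having \<open>ws\<close> as a facet. Each of them is obtained by adding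
  one vertex \<open>v\<close> to \<open>ws\<close> and, oriented as \<open>v # ws\<close>, has \<open>ws\<close> as its face number \<open>0\<close>, with sign
  \<open>+1\<close>. The case \<open>ws = []\<close> is excluded because homology is not reduced: \<open>0\<close>-chains have boundary
  zero.\<close>

definition boundary :: "('k, 'm) ring_scheme \<Rightarrow> ('a list \<Rightarrow> 'k) \<Rightarrow> 'a list \<Rightarrow> 'k" where
  "boundary K c ws =
     (if ws = [] then \<zero>\<^bsub>K\<^esub> else \<Oplus>\<^bsub>K\<^esub>v\<in>{v. c (v # ws) \<noteq> \<zero>\<^bsub>K\<^esub>}. c (v # ws))"

definition cycles :: "('k, 'm) ring_scheme \<Rightarrow> 'a set set \<Rightarrow> nat \<Rightarrow> ('a list \<Rightarrow> 'k) set" where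
  "cycles K \<Delta> n = {c \<in> chains K \<Delta> n. boundary K c = (\<lambda>_. \<zero>\<^bsub>K\<^esub>)}"

definition boundaries :: "('k, 'm) ring_scheme \<Rightarrow> 'a set set \<Rightarrow> nat \<Rightarrow> ('a list \<Rightarrow> 'k) set" where
  "boundaries K \<Delta> n = boundary K ` chains K \<Delta> (Suc n)"

definition cycle_module ::
  "('k, 'm) ring_scheme \<Rightarrow> 'a set set \<Rightarrow> nat \<Rightarrow> ('k, 'a list \<Rightarrow> 'k) module" where
  "cycle_module K \<Delta> n =
     \<lparr>carrier = cycles K \<Delta> n, mult = undefined, one = undefined,
      zero = (\<lambda>_. \<zero>\<^bsub>K\<^esub>), add = (\<lambda>c c' xs. c xs \<oplus>\<^bsub>K\<^esub> c' xs),
      smult = (\<lambda>a c xs. a \<otimes>\<^bsub>K\<^esub> c xs)\<rparr>"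

definition homology ::
  "('k, 'm) ring_scheme \<Rightarrow> 'a set set \<Rightarrow> nat \<Rightarrow> ('k, ('a list \<Rightarrow> 'k) set) module" where
  "homology K \<Delta> n = quotient_module (cycle_module K \<Delta> n) (boundaries K \<Delta> n)"

text \<open>The map into \<open>homology K \<Delta> n\<close> induced by the inclusion of a subcomplex of \<open>\<Delta>\<close>. It sends the
  class of a cycle \<open>z\<close> of the subcomplex to the class of \<open>z\<close> in \<open>\<Delta>\<close>.\<close>

definition homology_inclusion :: "('k, 'm) ring_scheme \<Rightarrow> 'a set set \<Rightarrow> nat \<Rightarrow>
    ('a list \<Rightarrow> 'k) set \<Rightarrow> ('a list \<Rightarrow> 'k) set" where
  "homology_inclusion K \<Delta> n C = (\<Union>z\<in>C. boundaries K \<Delta> n +>\<^bsub>cycle_module K \<Delta> n\<^esub> z)"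


section \<open>Persistence modules\<close>

text \<open>Objects and morphisms are only constrained at nonnegative parameters, and structure maps
  only on the carriers of their domains.\<close>

record ('k, 'v) persistence =
  obj :: "real \<Rightarrow> ('k, 'v) module"
  str :: "real \<Rightarrow> real \<Rightarrow> 'v \<Rightarrow> 'v"

definition persistence_module ::
  "('k, 'm) ring_scheme \<Rightarrow> ('k, 'v) persistence \<Rightarrow> bool" where
  "persistence_module K F \<longleftrightarrow>
     (\<forall>r\<ge>0. module K (obj F r)) \<and>
     (\<forall>r s. 0 \<le> r \<and> r \<le> s \<longrightarrow> str F r s \<in> linear_maps (obj F r) (obj F s) K) \<and>
     (\<forall>r\<ge>0. \<forall>x\<in>carrier (obj F r). str F r r x = x) \<and>
     (\<forall>r s t. 0 \<le> r \<and> r \<le> s \<and> s \<le> t \<longrightarrow>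
        (\<forall>x\<in>carrier (obj F r). str F s t (str F r s x) = str F r t x))"

definition rescale :: "real \<Rightarrow> ('k, 'v) persistence \<Rightarrow> ('k, 'v) persistence" where
  "rescale c F = \<lparr>obj = (\<lambda>r. obj F (c * r)), str = (\<lambda>r s. str F (c * r) (c * s))\<rparr>"

definition natural_transformation :: "('k, 'm) ring_scheme \<Rightarrow>
    ('k, 'v) persistence \<Rightarrow> ('k, 'w) persistence \<Rightarrow> (real \<Rightarrow> 'v \<Rightarrow> 'w) \<Rightarrow> bool" where
  "natural_transformation K F G \<phi> \<longleftrightarrow>
     (\<forall>r\<ge>0. \<phi> r \<in> linear_maps (obj F r) (obj G r) K) \<and>
     (\<forall>r s. 0 \<le> r \<and> r \<le> s \<longrightarrow>
        (\<forall>x\<in>carrier (obj F r). str G r s (\<phi> r x) = \<phi> s (str F r s x)))"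

definition approximated :: "('k, 'm) ring_scheme \<Rightarrow> real \<Rightarrow>
    ('k, 'v) persistence \<Rightarrow> ('k, 'w) persistence \<Rightarrow> bool" where
  "approximated K c F G \<longleftrightarrow>
     1 \<le> c \<and> persistence_module K F \<and> persistence_module K G \<and>
     (\<exists>\<phi> \<psi>. natural_transformation K F (rescale c G) \<phi> \<and>
            natural_transformation K G (rescale c F) \<psi> \<and>
            (\<forall>r\<ge>0. \<forall>x\<in>carrier (obj F r). \<psi> (c * r) (\<phi> r x) = str F r (c\<^sup>2 * r) x) \<and>
            (\<forall>r\<ge>0. \<forall>x\<in>carrier (obj G r). \<phi> (c * r) (\<psi> r x) = str G r (c\<^sup>2 * r) x))"

definition persistent_homology :: "('k, 'm) ring_scheme \<Rightarrow> (real \<Rightarrow> 'a set set) \<Rightarrow> nat \<Rightarrow>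
    ('k, ('a list \<Rightarrow> 'k) set) persistence" where
  "persistent_homology K \<Delta> n =
     \<lparr>obj = (\<lambda>r. homology K (\<Delta> r) n), str = (\<lambda>r s. homology_inclusion K (\<Delta> s) n)\<rparr>"

end

theory Submission
  imports Defs
begin

text \<open>The filtrations are interleaved as simplicial complexes: any vertex of a clique of diameter
  at most \<open>r\<close> lies in all the \<open>r\<close>-balls around the other vertices, and points whose \<open>r\<close>-balls
  share a point are at distance at most \<open>2 * r\<close> from each other, hence lie in a common maximal
  clique by Zorn's lemma. All maps in the definition of approximation are induced by
  inclusions, so the required identities hold because inclusions compose.\<close>


section \<open>Quotient modules\<close>

lemma (in module) submodule_abelian_subgroup:
  assumes "submodule N R M"
  shows "abelian_subgroup N M"
  using a_comm_group submodule.axioms(1)[OF assms] by (rule abelian_subgroupI2)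

text \<open>The scalar action of \<open>quotient_module\<close> is a union over all representatives
  of a coset. Representatives differ by elements of \<open>N\<close>, and \<open>N\<close> is closed
  under scalars, so all cosets in this union agree.\<close>

lemma quotient_smult_coset:
  fixes R (structure) and M :: "('r, 'v) module"
  assumes "module R M" and N: "submodule N R M" and a: "a \<in> carrier R" and x: "x \<in> carrier M"
  shows "a \<odot>\<^bsub>quotient_module M N\<^esub> (N +>\<^bsub>M\<^esub> x) = N +>\<^bsub>M\<^esub> (a \<odot>\<^bsub>M\<^esub> x)"
proof -
  interpret module R M by fact
  interpret N: abelian_subgroup N M by (rule submodule_abelian_subgroup[OF N])
  have "N +>\<^bsub>M\<^esub> (a \<odot>\<^bsub>M\<^esub> y) = N +>\<^bsub>M\<^esub> (a \<odot>\<^bsub>M\<^esub> x)" if y: "y \<in> N +>\<^bsub>M\<^esub> x" for y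
  proof -
    obtain h where h: "h \<in> N" "y = h \<oplus>\<^bsub>M\<^esub> x"
      using y by (auto simp: a_r_coset_def')
    have ah: "a \<odot>\<^bsub>M\<^esub> h \<in> N"
      using submodule.smult_closed[OF N a h(1)] .
    have "a \<odot>\<^bsub>M\<^esub> y = a \<odot>\<^bsub>M\<^esub> h \<oplus>\<^bsub>M\<^esub> a \<odot>\<^bsub>M\<^esub> x"
      using h a x N.a_subset by (auto intro: smult_r_distr)
    then have "a \<odot>\<^bsub>M\<^esub> y \<in> N +>\<^bsub>M\<^esub> (a \<odot>\<^bsub>M\<^esub> x)"
      using ah by (auto simp: a_r_coset_def')
    then show ?thesis
      using N.a_repr_independence' N.a_subgroup a x by (metis M.a_repr_independence smult_closed)
  qed
  moreover have "x \<in> N +>\<^bsub>M\<^esub> x"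
    using x by (rule N.a_rcos_self)
  ultimately have "(\<Union>y\<in>N +>\<^bsub>M\<^esub> x. N +>\<^bsub>M\<^esub> (a \<odot>\<^bsub>M\<^esub> y)) = N +>\<^bsub>M\<^esub> (a \<odot>\<^bsub>M\<^esub> x)"
    by (intro SUP_eq_const) blast+
  then show ?thesis
    by (simp add: quotient_module_def)
qed

text \<open>Every operation can be computed on representatives, so each module axiom descends from
  \<open>M\<close>.\<close>

lemma module_quotient_module:
  fixes R (structure) and M :: "('r, 'v) module"
  assumes M: "module R M" and N: "submodule N R M"
  shows "module R (quotient_module M N)"
proof -
  interpret module R M by (rule M)
  interpret N: abelian_subgroup N M by (rule submodule_abelian_subgroup[OF N])
  let ?Q = "quotient_module M N"
  have car: "carrier ?Q = {N +>\<^bsub>M\<^esub> x |x. x \<in> carrier M}"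
    by (auto simp: quotient_module_def A_RCOSETS_def')
  have add: "(N +>\<^bsub>M\<^esub> x) \<oplus>\<^bsub>?Q\<^esub> (N +>\<^bsub>M\<^esub> y) = N +>\<^bsub>M\<^esub> (x \<oplus>\<^bsub>M\<^esub> y)"
    if "x \<in> carrier M" "y \<in> carrier M" for x y
    using N.a_rcos_sum[OF that] by (simp add: quotient_module_def)
  \<comment> \<open>The zero of the record is \<open>N\<close> itself; written as a coset it fits
    the rule \<open>add\<close>.\<close>
  have zero: "\<zero>\<^bsub>?Q\<^esub> = N +>\<^bsub>M\<^esub> \<zero>\<^bsub>M\<^esub>"
    using M.a_coset_add_zero[OF N.a_subset] by (simp add: quotient_module_def)
  have grp: "abelian_group ?Q"
  proof (rule abelian_groupI)
    fix x assume "x \<in> carrier ?Q"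
    then obtain x' where x': "x' \<in> carrier M" "x = N +>\<^bsub>M\<^esub> x'"
      using car by auto
    then have "(N +>\<^bsub>M\<^esub> (\<ominus>\<^bsub>M\<^esub> x')) \<oplus>\<^bsub>?Q\<^esub> x = \<zero>\<^bsub>?Q\<^esub>"
      by (simp add: add zero M.l_neg)
    then show "\<exists>y\<in>carrier ?Q. y \<oplus>\<^bsub>?Q\<^esub> x = \<zero>\<^bsub>?Q\<^esub>"
      using x' by (intro bexI[where x = "N +>\<^bsub>M\<^esub> (\<ominus>\<^bsub>M\<^esub> x')"]) (auto simp: car)
  next
    fix x y assume "x \<in> carrier ?Q" "y \<in> carrier ?Q"
    then obtain x' y' where x': "x' \<in> carrier M" "x = N +>\<^bsub>M\<^esub> x'"
      and y': "y' \<in> carrier M" "y = N +>\<^bsub>M\<^esub> y'"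
      using car by auto
    show "x \<oplus>\<^bsub>?Q\<^esub> y \<in> carrier ?Q"
      using x' y' by (auto simp: car add)
    show "x \<oplus>\<^bsub>?Q\<^esub> y = y \<oplus>\<^bsub>?Q\<^esub> x"
      using x' y' by (simp add: add M.a_comm)
  qed (auto simp: car add zero M.a_assoc)
  note smult = quotient_smult_coset[OF M N]
  show ?thesis
  proof (rule moduleI[OF R.is_cring grp])
    fix x assume "x \<in> carrier ?Q"
    then obtain x' where x': "x' \<in> carrier M" "x = N +>\<^bsub>M\<^esub> x'"
      using car by auto
    show "\<one> \<odot>\<^bsub>?Q\<^esub> x = x"
      using x' by (simp add: smult)
    fix a assume a: "a \<in> carrier R"
    show "a \<odot>\<^bsub>?Q\<^esub> x \<in> carrier ?Q"
      using a x' by (auto simp: smult car)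
    {
      fix y assume "y \<in> carrier ?Q"
      then obtain y' where y': "y' \<in> carrier M" "y = N +>\<^bsub>M\<^esub> y'"
        using car by auto
      show "a \<odot>\<^bsub>?Q\<^esub> (x \<oplus>\<^bsub>?Q\<^esub> y) = (a \<odot>\<^bsub>?Q\<^esub> x) \<oplus>\<^bsub>?Q\<^esub> (a \<odot>\<^bsub>?Q\<^esub> y)"
        using a x' y' by (simp add: smult add smult_r_distr)
    }
    fix b assume b: "b \<in> carrier R"
    show "(a \<oplus> b) \<odot>\<^bsub>?Q\<^esub> x = (a \<odot>\<^bsub>?Q\<^esub> x) \<oplus>\<^bsub>?Q\<^esub> (b \<odot>\<^bsub>?Q\<^esub> x)"
      using a b x' by (simp add: smult add smult_l_distr)
    show "(a \<otimes> b) \<odot>\<^bsub>?Q\<^esub> x = a \<odot>\<^bsub>?Q\<^esub> (b \<odot>\<^bsub>?Q\<^esub> x)"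
      using a b x' by (simp add: smult smult_assoc1)
  qed
qed


section \<open>The chain complex of a simplicial complex\<close>

text \<open>The axiom of abstract simplicial complexes that keeps the boundary of a chain supported
  on the same complex. The empty face is exempt because nerves and co-nerves consist of nonempty
  simplices.\<close>

definition face_closed :: "'a set set \<Rightarrow> bool" where
  "face_closed \<Delta> \<longleftrightarrow> (\<forall>\<sigma>\<in>\<Delta>. \<forall>\<tau>. \<tau> \<subseteq> \<sigma> \<and> \<tau> \<noteq> {} \<longrightarrow> \<tau> \<in> \<Delta>)"

text \<open>A coefficient of \<open>boundary K c\<close> at nonempty \<open>ws\<close> reads
  \<open>c\<close> at the lists \<open>v # ws\<close>, so a reordering of \<open>ws\<close> has to
  be extended to \<open>v # ws\<close> with its sign kept.\<close>

lemma permute_list_Cons_lift: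
  assumes "p permutes {..<length xs}"
  obtains q where "q permutes {..<length (x # xs)}"
    and "permute_list q (x # xs) = x # permute_list p xs"
    and "evenperm q \<longleftrightarrow> evenperm p"
proof
  define A where "A = {..<length xs}"
  \<comment> \<open>Transport along \<open>Suc\<close> shifts \<open>p\<close> by one position:
    index 0, the head of the list, becomes a fixed point, and parity is kept because
    \<open>Suc\<close> is injective.\<close>
  define r where "r = map_permutation A Suc p"
  have p: "p permutes A" using assms by (simp add: A_def)
  have r: "r permutes Suc ` A"
    unfolding r_def by (intro map_permutation_permutes p) (auto simp: bij_betw_def)
  moreover have "Suc ` A \<subseteq> {..<length (x # xs)}"
    by (auto simp: A_def)
  ultimately show rp: "r permutes {..<length (x # xs)}"
    by (rule permutes_subset)
  have "r 0 = 0"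
    by (rule permutes_not_in[OF r]) auto
  moreover have "r (Suc i) = Suc (p i)" if "i < length xs" for i
    using that unfolding r_def A_def by (intro map_permutation_apply) auto
  ultimately show "permute_list r (x # xs) = x # permute_list p xs"
    by (auto simp: permute_list_def map_upt_Suc simp del: upt_Suc)
  show "evenperm r \<longleftrightarrow> evenperm p"
    unfolding r_def by (intro evenperm_map_permutation p) (auto simp: A_def)
qed

lemma chains_mono: "\<Delta> \<subseteq> \<Delta>' \<Longrightarrow> chains K \<Delta> n \<subseteq> chains K \<Delta>' n"
  unfolding chains_def by auto

lemma cycles_mono: "\<Delta> \<subseteq> \<Delta>' \<Longrightarrow> cycles K \<Delta> n \<subseteq> cycles K \<Delta>' n"
  using chains_mono[of \<Delta> \<Delta>' K n] unfolding cycles_def by blast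

lemma boundaries_mono: "\<Delta> \<subseteq> \<Delta>' \<Longrightarrow> boundaries K \<Delta> n \<subseteq> boundaries K \<Delta>' n"
  using chains_mono[of \<Delta> \<Delta>' K "Suc n"] unfolding boundaries_def by blast

lemma chains_closed: "c \<in> chains K \<Delta> n \<Longrightarrow> c xs \<in> carrier K"
  by (auto simp: chains_def)

text \<open>Each such \<open>v\<close> is the head of a list in the finite support of
  \<open>c\<close>. Hence the sum in \<open>boundary\<close> is a genuine one and not the default
  value of an infinite \<open>finsum\<close>.\<close>

lemma finite_chains_cofaces:
  assumes "c \<in> chains K \<Delta> n"
  shows "finite {v. c (v # ws) \<noteq> \<zero>\<^bsub>K\<^esub>}"
proof -
  have "finite {xs. c xs \<noteq> \<zero>\<^bsub>K\<^esub>}" using assms by (auto simp: chains_def)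
  then show ?thesis
    by (rule finite_surj[where f = hd]) (force simp: image_iff)
qed

context cring
begin

section \<open>Module operations on chains\<close>

lemma zero_in_chains: "(\<lambda>_. \<zero>) \<in> chains R \<Delta> n"
  by (auto simp: chains_def)

lemma add_in_chains:
  assumes "c \<in> chains R \<Delta> n" "c' \<in> chains R \<Delta> n"
  shows "(\<lambda>xs. c xs \<oplus> c' xs) \<in> chains R \<Delta> n"
proof -
  have "{xs. c xs \<oplus> c' xs \<noteq> \<zero>} \<subseteq> {xs. c xs \<noteq> \<zero>} \<union> {xs. c' xs \<noteq> \<zero>}"
    by auto
  then have "finite {xs. c xs \<oplus> c' xs \<noteq> \<zero>}"
    by (rule finite_subset) (use assms in \<open>auto simp: chains_def\<close>)
  moreover have "distinct xs \<and> length xs = Suc n \<and> set xs \<in> \<Delta>" if "c xs \<oplus> c' xs \<noteq> \<zero>" for xs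
  proof -
    have "c xs \<noteq> \<zero> \<or> c' xs \<noteq> \<zero>" using that by auto
    then show ?thesis using assms by (auto simp: chains_def)
  qed
  moreover have "c (permute_list p xs) \<oplus> c' (permute_list p xs)
      = (if evenperm p then c xs \<oplus> c' xs else \<ominus> (c xs \<oplus> c' xs))"
    if "p permutes {..<length xs}" for xs p
    using assms that chains_closed[OF assms(1)] chains_closed[OF assms(2)]
    by (simp add: chains_def minus_add)
  ultimately show ?thesis
    using chains_closed[OF assms(1)] chains_closed[OF assms(2)] by (auto simp: chains_def)
qed

lemma smult_in_chains:
  assumes "a \<in> carrier R" "c \<in> chains R \<Delta> n"
  shows "(\<lambda>xs. a \<otimes> c xs) \<in> chains R \<Delta> n"
proof -
  have "{xs. a \<otimes> c xs \<noteq> \<zero>} \<subseteq> {xs. c xs \<noteq> \<zero>}"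
    using assms by auto
  then have "finite {xs. a \<otimes> c xs \<noteq> \<zero>}"
    by (rule finite_subset) (use assms in \<open>auto simp: chains_def\<close>)
  moreover have "distinct xs \<and> length xs = Suc n \<and> set xs \<in> \<Delta>" if "a \<otimes> c xs \<noteq> \<zero>" for xs
  proof -
    have "c xs \<noteq> \<zero>" using that assms by auto
    then show ?thesis using assms by (auto simp: chains_def)
  qed
  moreover have "a \<otimes> c (permute_list p xs) = (if evenperm p then a \<otimes> c xs else \<ominus> (a \<otimes> c xs))"
    if "p permutes {..<length xs}" for xs p
    using assms that chains_closed[OF assms(2)] by (simp add: chains_def r_minus)
  ultimately show ?thesis
    using chains_closed[OF assms(2)] assms(1) by (auto simp: chains_def)
qed

text \<open>Enlarging the index set adds only zero terms. This frees the sum from the support of one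
  particular chain, so that sums for several chains can share an index set.\<close>

lemma boundary_eq_finsum:
  assumes "\<And>xs. c xs \<in> carrier R" "finite A" "{v. c (v # ws) \<noteq> \<zero>} \<subseteq> A" "ws \<noteq> []"
  shows "boundary R c ws = (\<Oplus>\<^bsub>R\<^esub>v\<in>A. c (v # ws))"
  unfolding boundary_def using assms
  by (auto intro!: add.finprod_mono_neutral_cong_left)

lemma boundary_closed: "(\<And>xs. c xs \<in> carrier R) \<Longrightarrow> boundary R c ws \<in> carrier R"
  by (auto simp: boundary_def intro!: finsum_closed)

lemma boundary_zero: "boundary R (\<lambda>_. \<zero>) = (\<lambda>_. \<zero>)"
  by (auto simp: boundary_def)

section \<open>Linearity and sign behaviour of the boundary map\<close>

lemma boundary_add:
  assumes "c \<in> chains R \<Delta> n" "c' \<in> chains R \<Delta>' n'"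
  shows "boundary R (\<lambda>xs. c xs \<oplus> c' xs) = (\<lambda>xs. boundary R c xs \<oplus> boundary R c' xs)"
proof
  fix ws
  \<comment> \<open>The two supports may differ, so all sums are taken over their union.\<close>
  let ?A = "{v. c (v # ws) \<noteq> \<zero>} \<union> {v. c' (v # ws) \<noteq> \<zero>}"
  have fin: "finite ?A" using assms finite_chains_cofaces by blast
  note cl = chains_closed[OF assms(1)] chains_closed[OF assms(2)]
  show "boundary R (\<lambda>xs. c xs \<oplus> c' xs) ws = boundary R c ws \<oplus> boundary R c' ws"
  proof (cases "ws = []")
    case True
    then show ?thesis by (simp add: boundary_def)
  next
    case False
    have "boundary R (\<lambda>xs. c xs \<oplus> c' xs) ws = (\<Oplus>\<^bsub>R\<^esub>v\<in>?A. c (v # ws) \<oplus> c' (v # ws))"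
      by (intro boundary_eq_finsum fin False) (auto simp: cl)
    also have "\<dots> = (\<Oplus>\<^bsub>R\<^esub>v\<in>?A. c (v # ws)) \<oplus> (\<Oplus>\<^bsub>R\<^esub>v\<in>?A. c' (v # ws))"
      by (intro finsum_addf) (auto simp: cl)
    also have "(\<Oplus>\<^bsub>R\<^esub>v\<in>?A. c (v # ws)) = boundary R c ws"
      by (intro boundary_eq_finsum[symmetric] fin False) (auto simp: cl)
    also have "(\<Oplus>\<^bsub>R\<^esub>v\<in>?A. c' (v # ws)) = boundary R c' ws"
      by (intro boundary_eq_finsum[symmetric] fin False) (auto simp: cl)
    finally show ?thesis .
  qed
qed

lemma boundary_smult:
  assumes "a \<in> carrier R" "c \<in> chains R \<Delta> n"
  shows "boundary R (\<lambda>xs. a \<otimes> c xs) = (\<lambda>xs. a \<otimes> boundary R c xs)"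
proof
  fix ws
  let ?A = "{v. c (v # ws) \<noteq> \<zero>}"
  have fin: "finite ?A" using assms finite_chains_cofaces by blast
  note cl = chains_closed[OF assms(2)]
  show "boundary R (\<lambda>xs. a \<otimes> c xs) ws = a \<otimes> boundary R c ws"
  proof (cases "ws = []")
    case True
    then show ?thesis using assms by (simp add: boundary_def)
  next
    case False
    have "boundary R (\<lambda>xs. a \<otimes> c xs) ws = (\<Oplus>\<^bsub>R\<^esub>v\<in>?A. a \<otimes> c (v # ws))"
      using assms by (intro boundary_eq_finsum fin False) (auto simp: cl)
    also have "\<dots> = a \<otimes> (\<Oplus>\<^bsub>R\<^esub>v\<in>?A. c (v # ws))"
      using assms fin by (intro finsum_rdistr[symmetric]) (auto simp: cl)
    also have "\<dots> = a \<otimes> boundary R c ws"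
      using False by (simp add: boundary_def)
    finally show ?thesis .
  qed
qed

text \<open>The lift of \<open>p\<close> fixes the added head, so every summand
  \<open>c (v # ws)\<close> changes by the same sign.\<close>

lemma boundary_permute_list:
  assumes c: "c \<in> chains R \<Delta> n" and p: "p permutes {..<length ws}"
  shows "boundary R c (permute_list p ws)
    = (if evenperm p then boundary R c ws else \<ominus> boundary R c ws)"
proof (cases "ws = []")
  case True
  then show ?thesis by (simp add: boundary_def)
next
  case False
  note cl = chains_closed[OF c]
  have perm: "c (v # permute_list p ws) = (if evenperm p then c (v # ws) else \<ominus> c (v # ws))" for v
  proof -
    obtain q where "q permutes {..<length (v # ws)}"
      "permute_list q (v # ws) = v # permute_list p ws" "evenperm q \<longleftrightarrow> evenperm p"
      by (rule permute_list_Cons_lift[OF p])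
    then show ?thesis using c unfolding chains_def mem_Collect_eq by metis
  qed
  let ?A = "{v. c (v # ws) \<noteq> \<zero>}"
  have fin: "finite ?A" using c finite_chains_cofaces by blast
  have ne: "permute_list p ws \<noteq> []"
    using False by (metis length_permute_list length_0_conv)
  have "boundary R c (permute_list p ws) = (\<Oplus>\<^bsub>R\<^esub>v\<in>?A. c (v # permute_list p ws))"
    by (intro boundary_eq_finsum fin ne cl) (auto simp: perm split: if_splits)
  also have "\<dots> = (if evenperm p then boundary R c ws else \<ominus> boundary R c ws)"
  proof (cases "evenperm p")
    case True
    then show ?thesis using False by (simp add: perm boundary_def)
  next
    case odd: False
    \<comment> \<open>Writing the sign as a factor \<open>\<ominus> \<one>\<close> lets
      distributivity pull it out of the sum.\<close>
    have "(\<Oplus>\<^bsub>R\<^esub>v\<in>?A. c (v # permute_list p ws)) = (\<Oplus>\<^bsub>R\<^esub>v\<in>?A. \<ominus> \<one> \<otimes> c (v # ws))"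
      using odd by (intro finsum_cong') (auto simp: perm cl l_minus)
    also have "\<dots> = \<ominus> \<one> \<otimes> (\<Oplus>\<^bsub>R\<^esub>v\<in>?A. c (v # ws))"
      using fin by (intro finsum_rdistr[symmetric]) (auto simp: cl)
    also have "\<dots> = \<ominus> boundary R c ws"
      using False by (simp add: boundary_def l_minus cl)
    finally show ?thesis using odd by simp
  qed
  finally show ?thesis .
qed

text \<open>A nonzero coefficient at \<open>ws\<close> comes from some \<open>v # ws\<close> in the
  support of \<open>c\<close>. So \<open>ws\<close> is the tail of one of finitely many lists, and
  its vertices span a face of a simplex of \<Delta>.\<close>

lemma boundary_in_chains:
  assumes \<Delta>: "face_closed \<Delta>" and c: "c \<in> chains R \<Delta> (Suc n)"
  shows "boundary R c \<in> chains R \<Delta> n"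
proof -
  have coface: "\<exists>v. c (v # ws) \<noteq> \<zero>" "ws \<noteq> []" if "boundary R c ws \<noteq> \<zero>" for ws
  proof -
    show "ws \<noteq> []" using that by (auto simp: boundary_def)
    show "\<exists>v. c (v # ws) \<noteq> \<zero>"
    proof (rule ccontr)
      assume "\<not> (\<exists>v. c (v # ws) \<noteq> \<zero>)"
      then have "{v. c (v # ws) \<noteq> \<zero>} = {}" by blast
      then show False using that unfolding boundary_def by (simp only: finsum_empty if_cancel simp_thms)
    qed
  qed
  have "{ws. boundary R c ws \<noteq> \<zero>} \<subseteq> tl ` {xs. c xs \<noteq> \<zero>}"
    using coface by force
  then have "finite {ws. boundary R c ws \<noteq> \<zero>}"
    by (rule finite_surj[rotated]) (use c in \<open>auto simp: chains_def\<close>)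
  moreover have "distinct ws \<and> length ws = Suc n \<and> set ws \<in> \<Delta>" if nz: "boundary R c ws \<noteq> \<zero>" for ws
  proof -
    obtain v where "c (v # ws) \<noteq> \<zero>" using coface nz by blast
    then have "distinct (v # ws) \<and> length (v # ws) = Suc (Suc n) \<and> set (v # ws) \<in> \<Delta>"
      using c unfolding chains_def by blast
    \<comment> \<open>Face-closedness yields only nonempty faces; \<open>ws\<close> is nonempty
      since \<open>boundary\<close> is set to zero at \<open>[]\<close>.\<close>
    moreover have "set ws \<subseteq> set (v # ws)" "set ws \<noteq> {}" using coface(2)[OF nz] by auto
    ultimately show ?thesis
      using \<Delta> unfolding face_closed_def by auto
  qed
  ultimately show ?thesis
    using boundary_permute_list[OF c] boundary_closed chains_closed[OF c]
    unfolding chains_def by blast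
qed

section \<open>The boundary of a boundary vanishes\<close>

lemma finsum_alternating:
  assumes "finite A" and cl: "\<And>u v. f u v \<in> carrier R"
    and diag: "\<And>u. f u u = \<zero>" and anti: "\<And>u v. f u v = \<ominus> f v u"
  shows "(\<Oplus>\<^bsub>R\<^esub>u\<in>A. \<Oplus>\<^bsub>R\<^esub>v\<in>A. f u v) = \<zero>"
  using assms(1)
proof (induction A rule: finite_induct)
  case empty
  then show ?case by simp
next
  \<comment> \<open>Enlarging \<open>A\<close> by \<open>a\<close> adds one row and one column to
    the square array of terms, and by antisymmetry these cancel.\<close>
  case (insert a A)
  have "(\<Oplus>\<^bsub>R\<^esub>u\<in>insert a A. \<Oplus>\<^bsub>R\<^esub>v\<in>insert a A. f u v)
    = (\<Oplus>\<^bsub>R\<^esub>v\<in>insert a A. f a v) \<oplus> (\<Oplus>\<^bsub>R\<^esub>u\<in>A. \<Oplus>\<^bsub>R\<^esub>v\<in>insert a A. f u v)"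
    using insert cl diag by (intro finsum_insert) auto
  \<comment> \<open>The corner \<open>f a a\<close> vanishes by \<open>diag\<close>; in
    characteristic 2 this would not follow from \<open>anti\<close>.\<close>
  also have "(\<Oplus>\<^bsub>R\<^esub>v\<in>insert a A. f a v) = (\<Oplus>\<^bsub>R\<^esub>v\<in>A. f a v)"
    using insert cl diag by (subst finsum_insert) auto
  also have "(\<Oplus>\<^bsub>R\<^esub>u\<in>A. \<Oplus>\<^bsub>R\<^esub>v\<in>insert a A. f u v) = (\<Oplus>\<^bsub>R\<^esub>u\<in>A. f u a \<oplus> (\<Oplus>\<^bsub>R\<^esub>v\<in>A. f u v))"
    using insert cl diag by (intro finsum_cong') auto
  also have "\<dots> = (\<Oplus>\<^bsub>R\<^esub>u\<in>A. f u a) \<oplus> (\<Oplus>\<^bsub>R\<^esub>u\<in>A. \<Oplus>\<^bsub>R\<^esub>v\<in>A. f u v)"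
    using cl by (intro finsum_addf) auto
  also have "\<dots> = (\<Oplus>\<^bsub>R\<^esub>u\<in>A. f u a)"
    using insert cl diag by simp
  also have "(\<Oplus>\<^bsub>R\<^esub>v\<in>A. f a v) \<oplus> (\<Oplus>\<^bsub>R\<^esub>u\<in>A. f u a) = (\<Oplus>\<^bsub>R\<^esub>v\<in>A. f a v \<oplus> f v a)"
    using cl by (intro finsum_addf[symmetric]) auto
  also have "\<dots> = (\<Oplus>\<^bsub>R\<^esub>v\<in>A. \<zero>)"
    using cl r_neg by (intro finsum_cong') (auto simp: anti[of _ a])
  finally show ?case by simp
qed

text \<open>The transposition of the first two positions is odd. This is the antisymmetry that
  \<open>finsum_alternating\<close> asks for.\<close>

lemma chains_swap:
  assumes "c \<in> chains R \<Delta> n"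
  shows "c (u # v # ws) = \<ominus> c (v # u # ws)"
proof -
  let ?p = "Transposition.transpose 0 (1::nat)"
  let ?xs = "v # u # ws"
  have "?p permutes {..<length ?xs}"
    by (rule permutes_swap_id) auto
  moreover have "permute_list ?p ?xs = u # v # ws"
    by (rule nth_equalityI) (auto simp: permute_list_def Transposition.transpose_def nth_Cons'
      simp del: upt_Suc)
  moreover have "\<not> evenperm ?p"
    by (simp add: evenperm_swap)
  ultimately show ?thesis
    using assms unfolding chains_def mem_Collect_eq by metis
qed

text \<open>The coefficient at nonempty \<open>ws\<close> is the sum of
  \<open>c (u # v # ws)\<close> over pairs \<open>u\<close>, \<open>v\<close>, and the two orders of
  adding a pair of vertices carry opposite signs.\<close>

lemma boundary_boundary:
  assumes c: "c \<in> chains R \<Delta> n"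
  shows "boundary R (boundary R c) = (\<lambda>_. \<zero>)"
proof
  fix ws
  show "boundary R (boundary R c) ws = \<zero>"
  proof (cases "ws = []")
    case True
    then show ?thesis by (simp add: boundary_def)
  next
    case False
    note cl = chains_closed[OF c]
    \<comment> \<open>The vertices occurring in the support of \<open>c\<close> form a finite range
      for both sums, so that the double sum runs over a square.\<close>
    define A where "A = \<Union> (set ` {xs. c xs \<noteq> \<zero>})"
    have fin: "finite A"
      using c by (auto simp: A_def chains_def)
    have A: "u \<in> A" "v \<in> A" if "c (u # v # ws) \<noteq> \<zero>" for u v
      using that by (force simp: A_def)+
    have inner: "boundary R c (v # ws) = (\<Oplus>\<^bsub>R\<^esub>u\<in>A. c (u # v # ws))" for v
      using A by (intro boundary_eq_finsum cl fin) auto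
    have "v \<in> A" if "boundary R c (v # ws) \<noteq> \<zero>" for v
    proof (rule ccontr)
      assume "v \<notin> A"
      then have "c (u # v # ws) = \<zero>" for u using A by blast
      then show False using that by (simp add: inner)
    qed
    then have "boundary R (boundary R c) ws = (\<Oplus>\<^bsub>R\<^esub>v\<in>A. boundary R c (v # ws))"
      by (intro boundary_eq_finsum fin False boundary_closed cl) auto
    also have "\<dots> = \<zero>"
      unfolding inner
    proof (rule finsum_alternating[OF fin])
      \<comment> \<open>The list repeats a vertex, and chains vanish on lists that are not
        distinct.\<close>
      show "c (u # u # ws) = \<zero>" for u
        using c unfolding chains_def by force
    qed (rule cl chains_swap[OF c])+
    finally show ?thesis .
  qed
qed


section \<open>Homology and inclusions\<close>

lemma module_cycle_module: "module R (cycle_module R \<Delta> n)"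
proof (rule moduleI)
  show "cring R" by (rule is_cring)
  have cl: "c xs \<in> carrier R" if "c \<in> cycles R \<Delta> n" for c xs
    using that by (auto simp: cycles_def chains_closed)
  have smult: "(\<lambda>xs. a \<otimes> c xs) \<in> cycles R \<Delta> n" if "a \<in> carrier R" "c \<in> cycles R \<Delta> n" for a c
    using that by (auto simp: cycles_def smult_in_chains boundary_smult)
  show "abelian_group (cycle_module R \<Delta> n)"
  proof (rule abelian_groupI)
    fix c assume "c \<in> carrier (cycle_module R \<Delta> n)"
    then have c: "c \<in> cycles R \<Delta> n" by (simp add: cycle_module_def)
    \<comment> \<open>The additive inverse is taken as the multiple by
      \<open>\<ominus> \<one>\<close>, so closure under scalars already makes it a cycle.\<close>
    then have "(\<lambda>xs. \<ominus> \<one> \<otimes> c xs) \<in> cycles R \<Delta> n" by (intro smult) auto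
    moreover have "\<ominus> \<one> \<otimes> c xs \<oplus> c xs = \<zero>" for xs
      using cl[OF c] by (simp add: l_minus l_neg)
    ultimately show "\<exists>y\<in>carrier (cycle_module R \<Delta> n).
        y \<oplus>\<^bsub>cycle_module R \<Delta> n\<^esub> c = \<zero>\<^bsub>cycle_module R \<Delta> n\<^esub>"
      by (auto simp: cycle_module_def intro!: bexI[where x = "\<lambda>xs. \<ominus> \<one> \<otimes> c xs"])
  qed (auto simp: cycle_module_def cl a_ac cycles_def zero_in_chains add_in_chains
      boundary_zero boundary_add chains_closed)
qed (auto simp: cycle_module_def cycles_def chains_closed smult_in_chains boundary_smult
    l_distr r_distr m_assoc)

text \<open>Boundaries are the image of a linear map. They are cycles by
  \<open>boundary_boundary\<close> and remain chains of \<Delta> by face-closedness.\<close>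

lemma submodule_boundaries:
  assumes \<Delta>: "face_closed \<Delta>"
  shows "submodule (boundaries R \<Delta> n) R (cycle_module R \<Delta> n)"
proof -
  interpret C: module R "cycle_module R \<Delta> n" by (rule module_cycle_module)
  have sub: "boundaries R \<Delta> n \<subseteq> carrier (cycle_module R \<Delta> n)"
    using boundary_in_chains[OF \<Delta>] boundary_boundary
    by (auto simp: boundaries_def cycle_module_def cycles_def)
  have smult: "a \<odot>\<^bsub>cycle_module R \<Delta> n\<^esub> b \<in> boundaries R \<Delta> n"
    if ab: "a \<in> carrier R" "b \<in> boundaries R \<Delta> n" for a b
  proof -
    obtain c where c: "c \<in> chains R \<Delta> (Suc n)" "b = boundary R c"
      using ab by (auto simp: boundaries_def)
    then have "(\<lambda>xs. a \<otimes> b xs) = boundary R (\<lambda>xs. a \<otimes> c xs)"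
      using boundary_smult[OF ab(1) c(1)] by simp
    then show ?thesis
      using smult_in_chains[OF ab(1) c(1)] by (auto simp: boundaries_def cycle_module_def)
  qed
  show ?thesis
  proof (rule C.submoduleI[OF sub])
    show "\<zero>\<^bsub>cycle_module R \<Delta> n\<^esub> \<in> boundaries R \<Delta> n"
      using zero_in_chains[of \<Delta> "Suc n"]
      by (auto simp: boundaries_def cycle_module_def boundary_zero
        intro!: image_eqI[where x = "\<lambda>_. \<zero>"])
    \<comment> \<open>Negation in the record is the derived group inverse, so it is first identified
      with scaling by \<open>\<ominus> \<one>\<close>.\<close>
    show "\<ominus>\<^bsub>cycle_module R \<Delta> n\<^esub> b \<in> boundaries R \<Delta> n" if "b \<in> boundaries R \<Delta> n" for b
      using smult[of "\<ominus> \<one>" b] that sub C.smult_l_minus[of \<one> b] by auto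
    show "b \<oplus>\<^bsub>cycle_module R \<Delta> n\<^esub> b' \<in> boundaries R \<Delta> n"
      if bb: "b \<in> boundaries R \<Delta> n" "b' \<in> boundaries R \<Delta> n" for b b'
    proof -
      obtain c c' where c: "c \<in> chains R \<Delta> (Suc n)" "b = boundary R c"
        "c' \<in> chains R \<Delta> (Suc n)" "b' = boundary R c'"
        using bb by (auto simp: boundaries_def)
      then have "(\<lambda>xs. b xs \<oplus> b' xs) = boundary R (\<lambda>xs. c xs \<oplus> c' xs)"
        using boundary_add[OF c(1,3)] by simp
      then show ?thesis
        using add_in_chains[OF c(1,3)] by (auto simp: boundaries_def cycle_module_def)
    qed
  qed (rule smult)
qed

abbreviation homology_class :: "'c set set \<Rightarrow> nat \<Rightarrow> ('c list \<Rightarrow> 'a) \<Rightarrow> ('c list \<Rightarrow> 'a) set" where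
  "homology_class \<Delta> n z \<equiv> boundaries R \<Delta> n +>\<^bsub>cycle_module R \<Delta> n\<^esub> z"

lemma module_homology: "face_closed \<Delta> \<Longrightarrow> module R (homology R \<Delta> n)"
  unfolding homology_def
  by (intro module_quotient_module module_cycle_module submodule_boundaries)

lemma carrier_homology: "carrier (homology R \<Delta> n) = homology_class \<Delta> n ` cycles R \<Delta> n"
  by (auto simp: homology_def quotient_module_def A_RCOSETS_def' cycle_module_def)

lemma homology_class_add:
  assumes "face_closed \<Delta>" "z \<in> cycles R \<Delta> n" "z' \<in> cycles R \<Delta> n"
  shows "homology_class \<Delta> n z \<oplus>\<^bsub>homology R \<Delta> n\<^esub> homology_class \<Delta> n z'
    = homology_class \<Delta> n (\<lambda>xs. z xs \<oplus> z' xs)"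
proof -
  interpret C: module R "cycle_module R \<Delta> n" by (rule module_cycle_module)
  interpret B: abelian_subgroup "boundaries R \<Delta> n" "cycle_module R \<Delta> n"
    by (intro C.submodule_abelian_subgroup submodule_boundaries assms)
  show ?thesis
    using B.a_rcos_sum[of z z'] assms(2,3)
    by (simp add: homology_def quotient_module_def) (simp add: cycle_module_def)
qed

lemma homology_class_smult:
  assumes "face_closed \<Delta>" "a \<in> carrier R" "z \<in> cycles R \<Delta> n"
  shows "a \<odot>\<^bsub>homology R \<Delta> n\<^esub> homology_class \<Delta> n z = homology_class \<Delta> n (\<lambda>xs. a \<otimes> z xs)"
proof -
  interpret C: module R "cycle_module R \<Delta> n" by (rule module_cycle_module)
  show ?thesis
    using quotient_smult_coset[OF C.module_axioms submodule_boundaries[OF assms(1)] assms(2), of z] assms(3)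
    by (simp add: homology_def) (simp add: cycle_module_def)
qed

text \<open>Cycles that differ by a boundary of \<Delta> differ by a boundary of \<Delta>', so all
  cosets in the union defining \<open>homology_inclusion\<close> coincide. The induced map can thus
  be computed on any representative.\<close>

lemma homology_inclusion_class:
  assumes \<Delta>: "face_closed \<Delta>" "face_closed \<Delta>'" "\<Delta> \<subseteq> \<Delta>'" and z: "z \<in> cycles R \<Delta> n"
  shows "homology_inclusion R \<Delta>' n (homology_class \<Delta> n z) = homology_class \<Delta>' n z"
proof -
  interpret C: module R "cycle_module R \<Delta> n" by (rule module_cycle_module)
  interpret B: abelian_subgroup "boundaries R \<Delta> n" "cycle_module R \<Delta> n"
    by (intro C.submodule_abelian_subgroup submodule_boundaries \<Delta>)
  interpret C': module R "cycle_module R \<Delta>' n" by (rule module_cycle_module)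
  interpret B': abelian_subgroup "boundaries R \<Delta>' n" "cycle_module R \<Delta>' n"
    by (intro C'.submodule_abelian_subgroup submodule_boundaries \<Delta>)
  have "z \<in> homology_class \<Delta> n z"
    using z by (intro B.a_rcos_self) (simp add: cycle_module_def)
  moreover have "homology_class \<Delta>' n y = homology_class \<Delta>' n z"
    if "y \<in> homology_class \<Delta> n z" for y
  proof -
    have "y \<in> homology_class \<Delta>' n z"
      using that boundaries_mono[OF \<Delta>(3)] by (auto simp: a_r_coset_def' cycle_module_def)
    moreover have "z \<in> carrier (cycle_module R \<Delta>' n)"
      using z cycles_mono[OF \<Delta>(3)] by (auto simp: cycle_module_def)
    ultimately show ?thesis
      using C'.a_repr_independence B'.a_subgroup by metis
  qed
  ultimately show ?thesis
    unfolding homology_inclusion_def by (intro SUP_eq_const) blast+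
qed

text \<open>The map keeps the representing cycle, and addition and scaling of cycles are given by
  the same pointwise formulas in both complexes.\<close>

lemma homology_inclusion_linear:
  assumes "face_closed \<Delta>" "face_closed \<Delta>'" "\<Delta> \<subseteq> \<Delta>'"
  shows "homology_inclusion R \<Delta>' n \<in> linear_maps (homology R \<Delta> n) (homology R \<Delta>' n) R"
proof -
  note sub = subsetD[OF cycles_mono[OF assms(3)], of _ R n]
  have "(\<lambda>xs. z xs \<oplus> z' xs) \<in> cycles R \<Delta> n" if "z \<in> cycles R \<Delta> n" "z' \<in> cycles R \<Delta> n" for z z'
    using that by (auto simp: cycles_def add_in_chains boundary_add)
  moreover have "(\<lambda>xs. a \<otimes> z xs) \<in> cycles R \<Delta> n" if "a \<in> carrier R" "z \<in> cycles R \<Delta> n" for a z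
    using that by (auto simp: cycles_def smult_in_chains boundary_smult)
  ultimately show ?thesis
    using sub
    by (auto simp: linear_maps_def carrier_homology homology_inclusion_class[OF assms]
      homology_class_add[OF assms(1)] homology_class_add[OF assms(2)]
      homology_class_smult[OF assms(1)] homology_class_smult[OF assms(2)])
qed

text \<open>Functoriality: all three maps keep the representing cycle. The composition law of
  persistence modules, naturality and the round-trip identities of the approximation all reduce to
  this.\<close>

lemma homology_inclusion_inclusion:
  assumes "face_closed \<Delta>" "face_closed \<Delta>'" "face_closed \<Delta>''" "\<Delta> \<subseteq> \<Delta>'" "\<Delta>' \<subseteq> \<Delta>''"
    and "x \<in> carrier (homology R \<Delta> n)"
  shows "homology_inclusion R \<Delta>'' n (homology_inclusion R \<Delta>' n x) = homology_inclusion R \<Delta>'' n x"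
proof -
  obtain z where z: "z \<in> cycles R \<Delta> n" "x = homology_class \<Delta> n z"
    using assms(6) by (auto simp: carrier_homology)
  moreover from z have "z \<in> cycles R \<Delta>' n"
    using cycles_mono[OF assms(4)] by blast
  moreover have "\<Delta> \<subseteq> \<Delta>''"
    using assms(4,5) by (rule subset_trans)
  ultimately show ?thesis
    by (simp add: homology_inclusion_class[OF assms(1,2,4)] homology_inclusion_class[OF assms(2,3,5)]
        homology_inclusion_class[OF assms(1,3)])
qed

lemma homology_inclusion_id:
  "face_closed \<Delta> \<Longrightarrow> x \<in> carrier (homology R \<Delta> n) \<Longrightarrow> homology_inclusion R \<Delta> n x = x"
  by (auto simp: carrier_homology homology_inclusion_class)

section \<open>Persistent homology of filtrations and their interleavings\<close>

lemma persistence_module_persistent_homology: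
  assumes "\<And>r. 0 \<le> r \<Longrightarrow> face_closed (F r)" "\<And>r s. 0 \<le> r \<Longrightarrow> r \<le> s \<Longrightarrow> F r \<subseteq> F s"
  shows "persistence_module R (persistent_homology R F n)"
  unfolding persistence_module_def persistent_homology_def persistence.simps
proof (intro conjI allI impI ballI)
  show "homology_inclusion R (F s) n \<in> linear_maps (homology R (F r) n) (homology R (F s) n) R"
    if "0 \<le> r \<and> r \<le> s" for r s
    using that assms by (intro homology_inclusion_linear) auto
  show "homology_inclusion R (F t) n (homology_inclusion R (F s) n x) = homology_inclusion R (F t) n x"
    if "0 \<le> r \<and> r \<le> s \<and> s \<le> t" "x \<in> carrier (homology R (F r) n)" for r s t x
    using that assms by (intro homology_inclusion_inclusion[of "F r"]) auto
qed (simp_all add: assms module_homology homology_inclusion_id)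

text \<open>Both ways around a naturality square are induced by the inclusion of \<open>F r\<close>
  into \<open>G (c * s)\<close>, one through \<open>G (c * r)\<close> and the other through
  \<open>F s\<close>.\<close>

lemma natural_transformation_homology_inclusion:
  assumes c: "0 \<le> c"
    and F: "\<And>r. 0 \<le> r \<Longrightarrow> face_closed (F r)" "\<And>r s. 0 \<le> r \<Longrightarrow> r \<le> s \<Longrightarrow> F r \<subseteq> F s"
    and G: "\<And>r. 0 \<le> r \<Longrightarrow> face_closed (G r)" "\<And>r s. 0 \<le> r \<Longrightarrow> r \<le> s \<Longrightarrow> G r \<subseteq> G s"
    and FG: "\<And>r. 0 \<le> r \<Longrightarrow> F r \<subseteq> G (c * r)"
  shows "natural_transformation R (persistent_homology R F n)
    (rescale c (persistent_homology R G n)) (\<lambda>r. homology_inclusion R (G (c * r)) n)"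
proof -
  have "homology_inclusion R (G (c * s)) n (homology_inclusion R (G (c * r)) n x)
      = homology_inclusion R (G (c * s)) n (homology_inclusion R (F s) n x)"
    if "0 \<le> r" "r \<le> s" "x \<in> carrier (homology R (F r) n)" for r s x
  proof -
    \<comment> \<open>The hypotheses on \<open>F\<close> and \<open>G\<close> speak of nonnegative
      scales only, hence these sign facts.\<close>
    have "0 \<le> s" "0 \<le> c * r" "c * r \<le> c * s" "0 \<le> c * s"
      using that c by (auto intro: mult_left_mono)
    then show ?thesis
      using that F G FG by (simp add: homology_inclusion_inclusion[of "F r"])
  qed
  moreover have "homology_inclusion R (G (c * r)) n
      \<in> linear_maps (homology R (F r) n) (homology R (G (c * r)) n) R" if "0 \<le> r" for r
    using that c F G FG by (intro homology_inclusion_linear) auto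
  ultimately show ?thesis
    by (simp add: natural_transformation_def persistent_homology_def rescale_def)
qed

text \<open>The comparison maps are induced by the inclusions \<open>FG\<close> and
  \<open>GF\<close>. Both round trips are then induced by inclusions as well, hence equal to
  structure maps.\<close>

lemma approximated_persistent_homology:
  assumes c: "1 \<le> c"
    and F: "\<And>r. 0 \<le> r \<Longrightarrow> face_closed (F r)" "\<And>r s. 0 \<le> r \<Longrightarrow> r \<le> s \<Longrightarrow> F r \<subseteq> F s"
    and G: "\<And>r. 0 \<le> r \<Longrightarrow> face_closed (G r)" "\<And>r s. 0 \<le> r \<Longrightarrow> r \<le> s \<Longrightarrow> G r \<subseteq> G s"
    and FG: "\<And>r. 0 \<le> r \<Longrightarrow> F r \<subseteq> G (c * r)" and GF: "\<And>r. 0 \<le> r \<Longrightarrow> G r \<subseteq> F (c * r)"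
  shows "approximated R c (persistent_homology R F n) (persistent_homology R G n)"
proof -
  have c0: "0 \<le> c" using c by simp
  \<comment> \<open>The path is \<open>F r\<close> \<subseteq> \<open>G (c * r)\<close> \<subseteq>
    \<open>F (c * (c * r))\<close>.\<close>
  have "homology_inclusion R (F (c * (c * r))) n (homology_inclusion R (G (c * r)) n x)
      = homology_inclusion R (F (c\<^sup>2 * r)) n x"
    if "0 \<le> r" "x \<in> carrier (homology R (F r) n)" for r x
    using that c0 F(1) G(1) FG GF
    by (simp add: homology_inclusion_inclusion[of "F r"] power2_eq_square mult.assoc)
  moreover have "homology_inclusion R (G (c * (c * r))) n (homology_inclusion R (F (c * r)) n x)
      = homology_inclusion R (G (c\<^sup>2 * r)) n x"
    if "0 \<le> r" "x \<in> carrier (homology R (G r) n)" for r x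
    using that c0 F(1) G(1) FG GF
    by (simp add: homology_inclusion_inclusion[of "G r"] power2_eq_square mult.assoc)
  ultimately show ?thesis
    unfolding approximated_def
    using c persistence_module_persistent_homology[of F n, OF F]
      persistence_module_persistent_homology[of G n, OF G]
      natural_transformation_homology_inclusion[of c F G n, OF c0 F G FG]
      natural_transformation_homology_inclusion[of c G F n, OF c0 G F GF]
    by (intro conjI exI[where x = "\<lambda>r. homology_inclusion R (G (c * r)) n"]
        exI[where x = "\<lambda>r. homology_inclusion R (F (c * r)) n"])
      (simp_all add: persistent_homology_def)
qed

end


section \<open>The Cech and Vietoris-Rips filtrations\<close>

lemma face_closed_nerve: "face_closed (nerve I U)"
proof -
  have "(\<Inter>i\<in>\<tau>. U i) \<noteq> {}" if "\<tau> \<subseteq> \<sigma>" "(\<Inter>i\<in>\<sigma>. U i) \<noteq> {}" for \<sigma> \<tau>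
    using that by blast
  then show ?thesis
    by (auto simp: face_closed_def nerve_def intro: finite_subset)
qed

lemma face_closed_conerve: "face_closed (conerve X I U)"
  by (auto simp: face_closed_def conerve_def intro: finite_subset)

text \<open>A supremum is bounded exactly when all its terms are. Since \<open>ennreal\<close> sends
  negative reals to 0, comparing values under it reflects the order of the reals only for a
  nonnegative bound.\<close>

lemma clique_iff:
  assumes "0 \<le> r"
  shows "clique X d r M \<longleftrightarrow> M \<subseteq> X \<and> (\<forall>x\<in>M. \<forall>y\<in>M. d x y \<le> r)"
  using assms by (simp add: clique_def diam_def SUP_le_iff ennreal_le_iff)

text \<open>Zorn's lemma applies to the cliques containing \<open>S\<close>: being a clique is a
  condition on pairs of points, so it passes to unions of chains.\<close>

lemma clique_extends_to_maximal:
  assumes r: "0 \<le> r" and S: "clique X d r S"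
  obtains M where "M \<in> maximal_cliques X d r" "S \<subseteq> M"
proof -
  let ?A = "{M. clique X d r M \<and> S \<subseteq> M}"
  have "\<exists>M\<in>?A. \<forall>M'\<in>?A. M \<subseteq> M' \<longrightarrow> M' = M"
  proof (rule subset_Zorn_nonempty)
    show "?A \<noteq> {}" using S by blast
    fix C assume C: "C \<noteq> {}" "subset.chain ?A C"
    have A: "clique X d r A" "S \<subseteq> A" if "A \<in> C" for A
      using C(2) that by (auto simp: subset.chain_def)
    \<comment> \<open>The larger of the two members of the chain contains both points.\<close>
    have "d x y \<le> r" if xy: "A \<in> C" "B \<in> C" "x \<in> A" "y \<in> B" for A B x y
    proof -
      have "A \<subset> B \<or> A = B \<or> B \<subset> A"
        using C(2) xy(1,2) unfolding subset.chain_def by blast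
      then have "x \<in> B \<and> y \<in> B \<or> x \<in> A \<and> y \<in> A"
        using xy(3,4) by blast
      then show ?thesis
        using A(1)[OF xy(1)] A(1)[OF xy(2)] r by (auto simp: clique_iff)
    qed
    moreover have "\<Union>C \<subseteq> X"
      using A(1) r by (auto simp: clique_iff)
    \<comment> \<open>This is where the chain has to be nonempty.\<close>
    moreover have "S \<subseteq> \<Union>C"
      using A(2) C(1) by blast
    ultimately show "\<Union>C \<in> ?A"
      using r by (auto simp: clique_iff)
  qed
  then obtain M where M: "clique X d r M" "S \<subseteq> M"
    "\<And>M'. clique X d r M' \<Longrightarrow> S \<subseteq> M' \<Longrightarrow> M \<subseteq> M' \<Longrightarrow> M' = M"
    by auto
  \<comment> \<open>A clique properly containing \<open>M\<close> would also contain
    \<open>S\<close>, so maximality above \<open>S\<close> is maximality among all cliques.\<close>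
  have "\<not> M \<subset> M'" if "clique X d r M'" for M'
    using M(2) M(3)[OF that] by auto
  with M(1) have "M \<in> maximal_cliques X d r"
    by (auto simp: maximal_cliques_def)
  then show thesis
    using M(2) by (rule that)
qed

text \<open>This recovers the usual pairwise-distance description. Subsets of cliques are cliques,
  and conversely a finite clique extends to a maximal one.\<close>

lemma vietoris_rips_iff:
  assumes "0 \<le> r"
  shows "\<sigma> \<in> vietoris_rips X d r \<longleftrightarrow>
    finite \<sigma> \<and> \<sigma> \<noteq> {} \<and> \<sigma> \<subseteq> X \<and> (\<forall>x\<in>\<sigma>. \<forall>y\<in>\<sigma>. d x y \<le> r)"
proof -
  have "(\<exists>M\<in>maximal_cliques X d r. \<sigma> \<subseteq> M) \<longleftrightarrow> clique X d r \<sigma>"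
  proof
    assume "\<exists>M\<in>maximal_cliques X d r. \<sigma> \<subseteq> M"
    then obtain M where "clique X d r M" "\<sigma> \<subseteq> M"
      unfolding maximal_cliques_def by blast
    then show "clique X d r \<sigma>"
      using assms by (simp add: clique_iff subset_iff)
  next
    assume "clique X d r \<sigma>"
    then show "\<exists>M\<in>maximal_cliques X d r. \<sigma> \<subseteq> M"
      by (rule clique_extends_to_maximal[OF assms]) blast
  qed
  then show ?thesis
    using assms by (auto simp: vietoris_rips_def conerve_def clique_iff)
qed

context Metric_space
begin

text \<open>The common point \<open>z\<close> of the balls lies in \<open>M\<close> because \<sigma>
  is nonempty and each ball is a subset of \<open>M\<close>.\<close>

lemma cech_iff:
  "\<sigma> \<in> cech M d r \<longleftrightarrow> finite \<sigma> \<and> \<sigma> \<noteq> {} \<and> \<sigma> \<subseteq> M \<and> (\<exists>z\<in>M. \<forall>x\<in>\<sigma>. d x z \<le> r)"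
  by (auto simp: cech_def nerve_def ball_cover_def mcball_def)

section \<open>Inclusions between the two filtrations\<close>

lemma cech_mono: "r \<le> s \<Longrightarrow> cech M d r \<subseteq> cech M d s"
  by (auto simp: cech_iff) (meson order_trans)

lemma vietoris_rips_mono: "0 \<le> r \<Longrightarrow> r \<le> s \<Longrightarrow> vietoris_rips M d r \<subseteq> vietoris_rips M d s"
  by (auto simp: vietoris_rips_iff) (meson order_trans)

text \<open>The factor 2 comes from the triangle inequality through the common point
  \<open>z\<close> of the balls.\<close>

lemma cech_subset_vietoris_rips:
  assumes "0 \<le> r"
  shows "cech M d r \<subseteq> vietoris_rips M d (2 * r)"
proof
  fix \<sigma> assume \<sigma>: "\<sigma> \<in> cech M d r"
  then obtain z where z: "z \<in> M" "\<forall>x\<in>\<sigma>. d x z \<le> r" by (auto simp: cech_iff)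
  have "d x y \<le> 2 * r" if "x \<in> \<sigma>" "y \<in> \<sigma>" for x y
  proof -
    have "x \<in> M" "y \<in> M" using \<sigma> that by (auto simp: cech_iff)
    then have "d x y \<le> d x z + d y z" using triangle'[of x z y] z by (simp add: commute)
    moreover have "d x z \<le> r" "d y z \<le> r" using z that by auto
    ultimately show ?thesis by simp
  qed
  then show "\<sigma> \<in> vietoris_rips M d (2 * r)"
    using \<sigma> assms by (auto simp: vietoris_rips_iff cech_iff)
qed

text \<open>Any vertex of the simplex serves as common point of the balls.\<close>

lemma vietoris_rips_subset_cech: "0 \<le> r \<Longrightarrow> vietoris_rips M d r \<subseteq> cech M d r"
  by (auto simp: cech_iff vietoris_rips_iff) (metis subsetD)

end

theorem corollary3p23:
  fixes K :: "('k, 'm) ring_scheme" and X :: "'a set" and d :: "'a \<Rightarrow> 'a \<Rightarrow> real"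
  assumes "field K" and "Metric_space X d"
  shows "\<forall>n. approximated K 2 (persistent_homology K (cech X d) n)
                              (persistent_homology K (vietoris_rips X d) n)"
proof -
  interpret Metric_space X d by fact
  interpret K: field K by fact
  \<comment> \<open>The inclusion already holds at scale \<open>r\<close>; it is weakened to
    \<open>2 * r\<close> because \<open>approximated\<close> uses one factor for both
    directions.\<close>
  have "vietoris_rips X d r \<subseteq> cech X d (2 * r)" if "0 \<le> r" for r
    using vietoris_rips_subset_cech[OF that] cech_mono[of r "2 * r"] that by auto
  moreover have "face_closed (cech X d r)" "face_closed (vietoris_rips X d r)" for r
    by (simp_all add: cech_def vietoris_rips_def face_closed_nerve face_closed_conerve)
  ultimately show ?thesis
    by (intro allI K.approximated_persistent_homology)
      (simp_all add: cech_mono vietoris_rips_mono cech_subset_vietoris_rips)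
qed

end
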